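(* Let $A=(a_{ij})$ be a real $n\times n$ matrix satisfying $$a_{ii} \geq a_{i,i+1} \geq \dots \geq a_{in} \geq a_{i1} \geq \dots \geq a_{i,i-1}, \qquad i=1,\dots,n,$$ and let $e$ be the vector of all ones. If $Ae>0$, then $\det A=0$ if the directed graph $\mathscr{G}(A)$ has more than one closed strongly connected component, and $\det A>0$ otherwise. If $Ae<0$, then $\det A=0$ if $\mathscr{G}(A)$ has more than one closed strongly connected component, and $\det A<0$ otherwise.
   Context: Vector inequalities are component-wise. The directed graph $\mathscr{G}(A)$ has vertex set $\{1,\dots,n\}$ and a directed edge from $i$ to $j$ if and only if $\kappa_{ij}=1$, where $\kappa_{ij}:=1$ if ($j=1$ and $a_{in}>a_{i1}$) or ($2\leq j\leq n$ and $a_{i,j-1}>a_{ij}$), and $\kappa_{ij}:=0$ otherwise. Two distinct vertices $i,j$ are strongly connected if there are directed paths in $\mathscr{G}(A)$ from $i$ to $j$ and from $j$ to $i$; every vertex is declared strongly connected to itself. The equivalence classes of this relation are the strongly connected components (SCCs). An SCC $C$ is open if there is a directed edge from a vertex in $C$ to a vertex not in $C$, and closed otherwise. *)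

theory Defs
  imports Jordan_Normal_Form.Determinant Graph_Theory.Digraph_Component Graph_Theory.Pair_Digraph
begin

text \<open>Matrices, and hence vertices, are indexed by \<open>0, \<dots>, n - 1\<close> instead of \<open>1, \<dots>, n\<close>.\<close>

text \<open>
  Read cyclically from the diagonal, every row is nonincreasing:
  \<open>a\<^sub>i\<^sub>,\<^sub>i \<ge> a\<^sub>i\<^sub>,\<^sub>i\<^sub>+\<^sub>1 \<ge> \<dots>\<close>, where the column
  after the last one is the first one, and the chain of \<open>n - 1\<close> inequalities stops just
  before it would return to the diagonal.
\<close>
definition cyclically_nonincreasing_rows :: "nat \<Rightarrow> real mat \<Rightarrow> bool" where
  "cyclically_nonincreasing_rows n A \<longleftrightarrow>
     (\<forall>i<n. \<forall>k. k + 1 < n \<longrightarrow> A $$ (i, (i + k) mod n) \<ge> A $$ (i, (i + k + 1) mod n))"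

definition kappa :: "nat \<Rightarrow> real mat \<Rightarrow> nat \<Rightarrow> nat \<Rightarrow> nat" where
  "kappa n A i j =
     (if (j = 0 \<and> A $$ (i, n - 1) > A $$ (i, 0)) \<or>
         (1 \<le> j \<and> j < n \<and> A $$ (i, j - 1) > A $$ (i, j))
      then 1 else 0)"

definition matrix_graph :: "nat \<Rightarrow> real mat \<Rightarrow> nat pair_pre_digraph" where
  "matrix_graph n A = \<lparr> pverts = {0..<n},
     parcs = {(i, j). i < n \<and> j < n \<and> kappa n A i j = 1} \<rparr>"

definition strong_connection :: "'a pair_pre_digraph \<Rightarrow> 'a rel" where
  "strong_connection G = {(i, j). i \<in> pverts G \<and> j \<in> pverts G \<and>
     (i = j \<or> (reachable (with_proj G) i j \<and> reachable (with_proj G) j i))}"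

definition SCCs :: "'a pair_pre_digraph \<Rightarrow> 'a set set" where
  "SCCs G = pverts G // strong_connection G"

definition open_SCC :: "'a pair_pre_digraph \<Rightarrow> 'a set \<Rightarrow> bool" where
  "open_SCC G C \<longleftrightarrow> C \<in> SCCs G \<and> (\<exists>i \<in> C. \<exists>j. j \<notin> C \<and> (i, j) \<in> parcs G)"

definition closed_SCC :: "'a pair_pre_digraph \<Rightarrow> 'a set \<Rightarrow> bool" where
  "closed_SCC G C \<longleftrightarrow> C \<in> SCCs G \<and> \<not> open_SCC G C"

text \<open>The strict order on \<^typ>\<open>real vec\<close> from the library is not componentwise strict.\<close>
definition vec_pos :: "real vec \<Rightarrow> bool" where
  "vec_pos v \<longleftrightarrow> (\<forall>i < dim_vec v. v $ i > 0)"

definition vec_neg :: "real vec \<Rightarrow> bool" where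
  "vec_neg v \<longleftrightarrow> (\<forall>i < dim_vec v. v $ i < 0)"

definition ones_vec :: "nat \<Rightarrow> real vec" where
  "ones_vec n = vec n (\<lambda>_. 1)"

lemma pair_wf_matrix_graph: "pair_wf_digraph (matrix_graph n A)"
  by unfold_locales (auto simp: matrix_graph_def)

lemma equiv_strong_connection:
  assumes "pair_wf_digraph G"
  shows "equiv (pverts G) (strong_connection G)"
proof -
  interpret pair_wf_digraph G by fact
  show ?thesis
    by (rule equivI)
       (auto simp: strong_connection_def refl_on_def sym_def trans_def intro: reachable_trans)
qed

lemma SCCs_eq_sccs_verts:
  assumes "pair_wf_digraph G"
  shows "SCCs G = pre_digraph.sccs_verts (with_proj G)"
proof -
  interpret pair_wf_digraph G by fact
  have mem: "v \<in> strong_connection G `` {u} \<longleftrightarrow>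
      reachable (with_proj G) u v \<and> reachable (with_proj G) v u"
    if "u \<in> pverts G" for u v
    using that by (auto simp: strong_connection_def dest: reachable_in_verts)
  show ?thesis
  proof (intro equalityI subsetI)
    fix S assume "S \<in> SCCs G"
    then obtain u where u: "u \<in> pverts G" and S: "S = strong_connection G `` {u}"
      by (auto simp: SCCs_def elim: quotientE)
    have "u \<in> S" using u unfolding S mem[OF u] by simp
    moreover have "reachable (with_proj G) x y" if "x \<in> S" "y \<in> S" for x y
      using that u unfolding S by (meson mem reachable_trans)
    moreover have "\<not> reachable (with_proj G) x y \<or> \<not> reachable (with_proj G) y x"
      if "x \<in> S" "y \<notin> S" for x y
      using that u unfolding S by (meson mem reachable_trans)
    ultimately show "S \<in> sccs_verts" unfolding sccs_verts_def by blast
  next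
    fix S assume S: "S \<in> sccs_verts"
    then obtain u where u: "u \<in> S" by (auto simp: sccs_verts_def)
    then have "reachable (with_proj G) u u" using S by (simp add: sccs_verts_def)
    then have uG: "u \<in> pverts G" using reachable_in_verts(1) by fastforce
    have "S = strong_connection G `` {u}"
      using S u mem[OF uG] unfolding sccs_verts_def by blast
    then show "S \<in> SCCs G" using uG by (auto simp: SCCs_def intro: quotientI)
  qed
qed

end

theory Submission
  imports Defs
begin

text \<open>
  Write \<open>S\<close> for the cyclic shift, so that \<open>L = A (I - S)\<close> is minus the matrix of cyclic row drops: its
  off-diagonal entries are \<open>\<le> 0\<close>, its row sums vanish, and its graph is the graph of \<open>A\<close>, so \<open>L\<close> is
  a digraph Laplacian.

  Every closed component \<open>C\<close> carries a nonzero \<open>x\<close> with \<open>x\<^sup>T L = 0\<close>, that is, \<open>x\<^sup>T A\<close> is a multiple of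
  \<open>e\<^sup>T\<close>. Two closed components give two such vectors with disjoint supports, and some nontrivial
  combination of them is annihilated by \<open>A\<close>.

  With a single closed component some vertex is reachable from all others. If \<open>A x = 0\<close>, split
  \<open>x = (I - S) v + c e\<close>; then \<open>L v = - c A e\<close>. Looking at a maximum and a minimum of \<open>v\<close> gives
  \<open>c = 0\<close>, the maximum principle makes \<open>v\<close> constant, and \<open>x = 0\<close>. So \<open>A\<close> is invertible. The
  hypotheses persist along the segment from \<open>A\<close> to a reference matrix, hence the sign of the
  determinant is that of the reference: the identity if \<open>A e > 0\<close>, minus the matrix of a cyclic
  permutation (determinant \<open>-1\<close> in every dimension) if \<open>A e < 0\<close>.
\<close>

section \<open>Cyclic row drops and their digraph\<close>

definition cyclic_pred :: "nat \<Rightarrow> nat \<Rightarrow> nat" where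
  "cyclic_pred n j = (if j = 0 then n - 1 else j - 1)"

text \<open>Matrices are passed as functions of two indices, so that segments and reference matrices
  are plain lambda terms.\<close>

definition cyclic_drop :: "nat \<Rightarrow> (nat \<Rightarrow> nat \<Rightarrow> real) \<Rightarrow> nat \<Rightarrow> nat \<Rightarrow> real" where
  "cyclic_drop n a i j = a i (cyclic_pred n j) - a i j"

definition drop_edges :: "nat \<Rightarrow> (nat \<Rightarrow> nat \<Rightarrow> real) \<Rightarrow> nat rel" where
  "drop_edges n a = {(i, j). i < n \<and> j < n \<and> cyclic_drop n a i j > 0}"

text \<open>The exempt diagonal drop is the cyclic step back to column \<open>i\<close>, the one
  step that the chain of row inequalities leaves out.\<close>

definition offdiag_drops_nonneg :: "nat \<Rightarrow> (nat \<Rightarrow> nat \<Rightarrow> real) \<Rightarrow> bool" where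
  "offdiag_drops_nonneg n a \<longleftrightarrow> (\<forall>i<n. \<forall>j<n. i \<noteq> j \<longrightarrow> cyclic_drop n a i j \<ge> 0)"

lemma ex_argmax_lessThan:
  fixes v :: "nat \<Rightarrow> 'a :: linorder"
  assumes "n \<ge> 1"
  obtains m where "m < n" "\<And>j. j < n \<Longrightarrow> v j \<le> v m"
proof -
  have "Max (v ` {..<n}) \<in> v ` {..<n}" using assms by (intro Max_in) (auto simp: lessThan_empty_iff)
  then obtain m where "m < n" "v m = Max (v ` {..<n})" by auto
  then show thesis by (intro that) auto
qed

lemma cyclic_pred_less: "j < n \<Longrightarrow> cyclic_pred n j < n"
  by (auto simp: cyclic_pred_def)

lemma sum_cyclic_shift:
  fixes g :: "nat \<Rightarrow> nat \<Rightarrow> real"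
  assumes "n \<ge> 1"
  shows "(\<Sum>j<n. g (cyclic_pred n j) j) = g (n - 1) 0 + (\<Sum>j<n - 1. g j (Suc j))"
proof -
  obtain m where "n = Suc m" using assms by (cases n) auto
  then show ?thesis
    by (simp add: sum.lessThan_Suc_shift cyclic_pred_def del: sum.lessThan_Suc)
qed

lemma sum_cyclic_drop:
  assumes "n \<ge> 1"
  shows "(\<Sum>j<n. cyclic_drop n a i j) = 0"
proof -
  obtain m where "n = Suc m" using assms by (cases n) auto
  then show ?thesis
    using sum_cyclic_shift[OF assms, of "\<lambda>k j. a i k"]
    by (simp add: cyclic_drop_def sum_subtractf)
qed

section \<open>Summation by parts and the maximum principle\<close>

text \<open>Abel summation around the cycle: \<open>v n = v 0\<close> removes the boundary term, and
  \<open>v i\<close> can be subtracted because the drops of a row sum to 0. This kills the diagonal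
  term, so only off-diagonal drops matter.\<close>

lemma summation_by_parts_cyclic:
  fixes v :: "nat \<Rightarrow> real"
  assumes "n \<ge> 1" "v n = v 0"
  shows "(\<Sum>j<n. a i j * (v (Suc j) - v j)) = (\<Sum>j<n. cyclic_drop n a i j * (v j - v i))"
proof -
  obtain m where m: "n = Suc m" using assms by (cases n) auto
  have "(\<Sum>j<n. cyclic_drop n a i j * (v j - v i)) =
        (\<Sum>j<n. cyclic_drop n a i j * v j) - (\<Sum>j<n. cyclic_drop n a i j) * v i"
    by (simp add: right_diff_distrib sum_subtractf sum_distrib_right)
  also have "\<dots> = (\<Sum>j<n. a i (cyclic_pred n j) * v j) - (\<Sum>j<n. a i j * v j)"
    using sum_cyclic_drop[OF assms(1)]
    by (simp add: cyclic_drop_def left_diff_distrib sum_subtractf)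
  also have "(\<Sum>j<n. a i (cyclic_pred n j) * v j) = (\<Sum>j<n. a i j * v (Suc j))"
    using sum_cyclic_shift[OF assms(1), of "\<lambda>k j. a i k * v j"] assms(2) m by simp
  finally show ?thesis
    by (simp add: right_diff_distrib sum_subtractf)
qed

lemma laplacian_nonpos_at_max:
  assumes "offdiag_drops_nonneg n a" "i < n" "\<And>j. j < n \<Longrightarrow> v j \<le> v i"
  shows "(\<Sum>j<n. cyclic_drop n a i j * (v j - v i)) \<le> (0::real)"
proof (rule sum_nonpos)
  fix j assume "j \<in> {..<n}"
  then show "cyclic_drop n a i j * (v j - v i) \<le> 0"
    using assms by (cases "i = j") (auto simp: offdiag_drops_nonneg_def mult_nonneg_nonpos)
qed

text \<open>Maximum principle: where \<open>v\<close> is maximal, all terms of the vanishing sum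
  have one sign, so each is 0 and \<open>v\<close> is maximal at every successor too. The maximum
  travels along a path to \<open>z\<close>.\<close>

lemma harmonic_le_sink:
  fixes v :: "nat \<Rightarrow> real"
  assumes nonneg: "offdiag_drops_nonneg n a"
    and harmonic: "\<And>i. i < n \<Longrightarrow> (\<Sum>j<n. cyclic_drop n a i j * (v j - v i)) = 0"
    and sink: "\<And>i. i < n \<Longrightarrow> (i, z) \<in> (drop_edges n a)\<^sup>*"
    and "i < n"
  shows "v i \<le> v z"
proof -
  obtain m where m: "m < n" "\<And>j. j < n \<Longrightarrow> v j \<le> v m"
    using ex_argmax_lessThan[of n v] \<open>i < n\<close> by auto
  have "v k = v m" if "(m, k) \<in> (drop_edges n a)\<^sup>*" for k
    using that
  proof (induction rule: rtrancl_induct)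
    case base show ?case ..
  next
    case (step p q)
    then have pq: "p < n" "q < n" "cyclic_drop n a p q > 0" by (auto simp: drop_edges_def)
    have "cyclic_drop n a p j * (v p - v j) \<ge> 0" if "j < n" for j
      using that pq nonneg m step.IH
      by (cases "j = p") (auto simp: offdiag_drops_nonneg_def)
    moreover have "(\<Sum>j<n. cyclic_drop n a p j * (v p - v j)) = 0"
      using harmonic[OF pq(1)]
        sum_negf[of "\<lambda>j. cyclic_drop n a p j * (v j - v p)" "{..<n}"]
      by (simp add: algebra_simps)
    ultimately have "cyclic_drop n a p q * (v p - v q) = 0"
      using pq(2) by (subst (asm) sum_nonneg_eq_0_iff) auto
    then show ?case using pq step.IH by auto
  qed
  from this[OF sink[OF m(1)]] m(2)[OF \<open>i < n\<close>] show ?thesis by simp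
qed

section \<open>Singularity and null vectors\<close>

lemma det_mat_0_iff:
  fixes a :: "nat \<Rightarrow> nat \<Rightarrow> real"
  shows "det (mat n n (\<lambda>(i, j). a i j)) = 0 \<longleftrightarrow>
    (\<exists>x. (\<exists>i<n. x i \<noteq> 0) \<and> (\<forall>i<n. (\<Sum>j<n. a i j * x j) = 0))" (is "?L \<longleftrightarrow> ?R")
proof
  assume ?L
  then obtain v where v: "v \<in> carrier_vec n" "v \<noteq> 0\<^sub>v n" "mat n n (\<lambda>(i, j). a i j) *\<^sub>v v = 0\<^sub>v n"
    using det_0_iff_vec_prod_zero_field[of "mat n n (\<lambda>(i, j). a i j)" n] by auto
  have "(\<Sum>j<n. a i j * v $ j) = 0" if "i < n" for i
    using arg_cong[OF v(3), of "\<lambda>u. u $ i"] that v(1)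
    by (simp add: scalar_prod_def lessThan_atLeast0)
  moreover have "\<exists>i<n. v $ i \<noteq> 0"
    using v(1,2) by (metis carrier_vecD eq_vecI index_zero_vec(1) index_zero_vec(2))
  ultimately show ?R by blast
next
  assume ?R
  then obtain x where x: "\<exists>i<n. x i \<noteq> 0" "\<And>i. i < n \<Longrightarrow> (\<Sum>j<n. a i j * x j) = 0" by blast
  have "vec n x \<noteq> 0\<^sub>v n" using x(1) by (metis index_vec index_zero_vec(1))
  moreover have "mat n n (\<lambda>(i, j). a i j) *\<^sub>v vec n x = 0\<^sub>v n"
    using x(2) by (intro eq_vecI) (auto simp: scalar_prod_def lessThan_atLeast0)
  ultimately show ?L
    using det_0_iff_vec_prod_zero_field[of "mat n n (\<lambda>(i, j). a i j)" n] by (metis mat_carrier vec_carrier)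
qed

lemma det_mat_0_iff_left:
  fixes a :: "nat \<Rightarrow> nat \<Rightarrow> real"
  shows "det (mat n n (\<lambda>(i, j). a i j)) = 0 \<longleftrightarrow>
    (\<exists>x. (\<exists>i<n. x i \<noteq> 0) \<and> (\<forall>j<n. (\<Sum>i<n. x i * a i j) = 0))"
proof -
  have "mat n n (\<lambda>(i, j). a j i) = transpose_mat (mat n n (\<lambda>(i, j). a i j))"
    by (intro eq_matI) auto
  then have "det (mat n n (\<lambda>(i, j). a i j)) = det (mat n n (\<lambda>(i, j). a j i))"
    by (metis det_transpose mat_carrier)
  then show ?thesis using det_mat_0_iff[of n "\<lambda>i j. a j i"] by (simp add: mult.commute)
qed

section \<open>Sign of the determinant in the presence of a sink\<close>

lemma det_nonzero_of_sink:
  fixes a :: "nat \<Rightarrow> nat \<Rightarrow> real"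
  assumes n: "n \<ge> 1" and nonneg: "offdiag_drops_nonneg n a"
    and same_sign: "\<And>i k. i < n \<Longrightarrow> k < n \<Longrightarrow> (\<Sum>j<n. a i j) * (\<Sum>j<n. a k j) > 0"
    and sink: "z < n" "\<And>i. i < n \<Longrightarrow> (i, z) \<in> (drop_edges n a)\<^sup>*"
  shows "det (mat n n (\<lambda>(i, j). a i j)) \<noteq> 0"
proof
  assume "det (mat n n (\<lambda>(i, j). a i j)) = 0"
  then obtain x where x: "\<exists>i<n. x i \<noteq> 0" "\<And>i. i < n \<Longrightarrow> (\<Sum>j<n. a i j * x j) = 0"
    unfolding det_mat_0_iff by blast
  \<comment> \<open>\<open>c\<close> is the mean of \<open>x\<close>, so the partial sums
    \<open>v\<close> of \<open>x - c\<close> return to 0 after \<open>n\<close> steps.\<close>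
  define c where "c = (\<Sum>j<n. x j) / n"
  define v where "v k = (\<Sum>j<k. x j - c)" for k
  have v_per: "v n = v 0" using n by (simp add: v_def c_def sum_subtractf)
  have x_eq: "x j = v (Suc j) - v j + c" for j by (simp add: v_def)
  have lap: "(\<Sum>j<n. cyclic_drop n a i j * (v j - v i)) = - c * (\<Sum>j<n. a i j)" if "i < n" for i
  proof -
    have "0 = (\<Sum>j<n. a i j * (v (Suc j) - v j)) + (\<Sum>j<n. a i j * c)"
      using x(2)[OF that] unfolding x_eq distrib_left sum.distrib by simp
    then show ?thesis
      unfolding summation_by_parts_cyclic[OF n v_per] sum_distrib_right[symmetric] by (simp add: algebra_simps)
  qed
  obtain p where p: "p < n" "\<And>j. j < n \<Longrightarrow> v j \<le> v p"
    using ex_argmax_lessThan[OF n, of v] by blast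
  obtain q where q: "q < n" "\<And>j. j < n \<Longrightarrow> v q \<le> v j"
    using ex_argmax_lessThan[OF n, of "\<lambda>j. - v j"] by auto
  have neg: "(\<Sum>j<n. cyclic_drop n a i j * (- v j - - v i)) =
      - (\<Sum>j<n. cyclic_drop n a i j * (v j - v i))" for i
    by (simp add: sum_negf[symmetric] algebra_simps)
  \<comment> \<open>The Laplacian sum is nonpositive at a maximum of \<open>v\<close> and
    nonnegative at a minimum. As the row sums at \<open>p\<close> and \<open>q\<close> have the same
    sign, \<open>c\<close> must vanish.\<close>
  have "- c * (\<Sum>j<n. a p j) \<le> 0" "- c * (\<Sum>j<n. a q j) \<ge> 0"
    using laplacian_nonpos_at_max[OF nonneg, of p v] laplacian_nonpos_at_max[OF nonneg, of q "\<lambda>j. - v j"]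
      p q lap neg[of q] by auto
  then have "c = 0" using same_sign[OF p(1) q(1)]
    by (auto simp: zero_less_mult_iff mult_le_0_iff zero_le_mult_iff)
  then have "v i \<le> v z \<and> - v i \<le> - v z" if "i < n" for i
    using harmonic_le_sink[OF nonneg _ sink(2) that, of v]
      harmonic_le_sink[OF nonneg _ sink(2) that, of "\<lambda>j. - v j"] lap neg by auto
  then have const: "v i = v z" if "i < n" for i using that by force
  \<comment> \<open>Index \<open>n\<close> is included because \<open>x (n - 1)\<close> involves
    \<open>v n\<close>.\<close>
  then have "v i = v z" if "i \<le> n" for i using v_per that n by (cases "i = n") auto
  then have "x j = 0" if "j < n" for j using that x_eq[of j] \<open>c = 0\<close> by auto
  then show False using x(1) by blast
qed

text \<open>By the Leibniz formula the determinant is continuous in \<open>t\<close>, so a change of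
  sign would force a zero on the segment.\<close>

lemma det_sgn_along_segment:
  fixes a b :: "nat \<Rightarrow> nat \<Rightarrow> real"
  assumes "\<And>t. 0 \<le> t \<Longrightarrow> t \<le> 1 \<Longrightarrow> det (mat n n (\<lambda>(i, j). (1 - t) * a i j + t * b i j)) \<noteq> 0"
  shows "sgn (det (mat n n (\<lambda>(i, j). a i j))) = sgn (det (mat n n (\<lambda>(i, j). b i j)))"
proof -
  define f where "f t = det (mat n n (\<lambda>(i, j). (1 - t) * a i j + t * b i j))" for t
  have f_eq: "f = (\<lambda>t. \<Sum>p | p permutes {0..<n}.
      signof p * (\<Prod>i = 0..<n. (1 - t) * a i (p i) + t * b i (p i)))"
  proof
    fix t
    have "f t = (\<Sum>p | p permutes {0..<n}. signof p *
        (\<Prod>i = 0..<n. mat n n (\<lambda>(i, j). (1 - t) * a i j + t * b i j) $$ (i, p i)))"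
      unfolding f_def by (rule det_def'[OF mat_carrier])
    also have "\<dots> = (\<Sum>p | p permutes {0..<n}.
        signof p * (\<Prod>i = 0..<n. (1 - t) * a i (p i) + t * b i (p i)))"
    proof (rule sum.cong[OF refl])
      fix p assume "p \<in> {p. p permutes {0..<n}}"
      then have "p i < n" if "i < n" for i
        using that permutes_in_image[of p "{0..<n}" i] by simp
      then show "signof p * (\<Prod>i = 0..<n. mat n n (\<lambda>(i, j). (1 - t) * a i j + t * b i j) $$ (i, p i)) =
          signof p * (\<Prod>i = 0..<n. (1 - t) * a i (p i) + t * b i (p i))"
        by simp
    qed
    finally show "f t = (\<Sum>p | p permutes {0..<n}.
        signof p * (\<Prod>i = 0..<n. (1 - t) * a i (p i) + t * b i (p i)))" .
  qed
  have cont: "continuous_on {0..1} f"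
    unfolding f_eq by (intro continuous_intros)
  have nz: "f t \<noteq> 0" if "0 \<le> t" "t \<le> 1" for t using assms that by (simp add: f_def)
  have "\<not> (f 0 \<le> 0 \<and> 0 \<le> f 1)" using IVT'[of f 0 0 1] cont nz by fastforce
  moreover have "\<not> (f 1 \<le> 0 \<and> 0 \<le> f 0)" using IVT2'[of f 1 0 0] cont nz by fastforce
  ultimately have "sgn (f 0) = sgn (f 1)" by (auto simp: sgn_if)
  then show ?thesis by (simp add: f_def)
qed

lemma cyclic_drop_convex:
  "cyclic_drop n (\<lambda>i j. (1 - t) * a i j + t * b i j) i j =
    (1 - t) * cyclic_drop n a i j + t * cyclic_drop n b i j"
  by (simp add: cyclic_drop_def algebra_simps)

text \<open>For \<open>t > 0\<close> the edges of \<open>b\<close> persist and \<open>y\<close>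
  stays a sink; \<open>t = 0\<close> gives \<open>a\<close> with its own sink \<open>z\<close>. The
  factor \<open>s\<close> covers both signs of the row sums.\<close>

lemma det_sgn_eq_of_sinks:
  fixes a b :: "nat \<Rightarrow> nat \<Rightarrow> real"
  assumes n: "n \<ge> 1"
    and a: "offdiag_drops_nonneg n a" "z < n" "\<And>i. i < n \<Longrightarrow> (i, z) \<in> (drop_edges n a)\<^sup>*"
    and b: "offdiag_drops_nonneg n b" "y < n" "\<And>i. i < n \<Longrightarrow> (i, y) \<in> (drop_edges n b)\<^sup>*"
    and b_diag: "\<And>i. i < n \<Longrightarrow> cyclic_drop n b i i \<le> 0"
    and same_sign: "\<And>i. i < n \<Longrightarrow> s * (\<Sum>j<n. a i j) > 0" "\<And>i. i < n \<Longrightarrow> s * (\<Sum>j<n. b i j) > 0"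
  shows "sgn (det (mat n n (\<lambda>(i, j). a i j))) = sgn (det (mat n n (\<lambda>(i, j). b i j)))"
proof (rule det_sgn_along_segment)
  fix t :: real assume t: "0 \<le> t" "t \<le> 1"
  let ?c = "\<lambda>i j. (1 - t) * a i j + t * b i j"
  have c: "offdiag_drops_nonneg n ?c"
    using a(1) b(1) t unfolding offdiag_drops_nonneg_def cyclic_drop_convex by simp
  have row: "s * (\<Sum>j<n. ?c i j) > 0" if "i < n" for i
  proof -
    have "s * (\<Sum>j<n. ?c i j) = (1 - t) * (s * (\<Sum>j<n. a i j)) + t * (s * (\<Sum>j<n. b i j))"
      unfolding sum.distrib sum_distrib_left[symmetric] by (simp add: algebra_simps)
    also have "\<dots> > 0" using same_sign[OF that] t
      by (cases "t = 0") (auto intro: add_nonneg_pos)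
    finally show ?thesis .
  qed
  have sq: "(\<Sum>j<n. ?c i j) * (\<Sum>j<n. ?c k j) > 0" if "i < n" "k < n" for i k
    using row[OF that(1)] row[OF that(2)] by (auto simp: zero_less_mult_iff)
  show "det (mat n n (\<lambda>(i, j). ?c i j)) \<noteq> 0"
  proof (cases "t = 0")
    case True
    then show ?thesis using det_nonzero_of_sink[OF n c sq a(2)] a(3) by simp
  next
    case False
    have "drop_edges n b \<subseteq> drop_edges n ?c"
    proof clarify
      fix i j assume "(i, j) \<in> drop_edges n b"
      then have ij: "i < n" "j < n" "cyclic_drop n b i j > 0" by (auto simp: drop_edges_def)
      \<comment> \<open>Edges of \<open>b\<close> lie off the diagonal, which is where the drops of
        \<open>a\<close> are known to be nonnegative.\<close>
      then have "i \<noteq> j" using b_diag by force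
      then have "cyclic_drop n a i j \<ge> 0" using a(1) ij by (simp add: offdiag_drops_nonneg_def)
      then show "(i, j) \<in> drop_edges n ?c"
        using ij t False unfolding drop_edges_def cyclic_drop_convex
        by (auto intro: add_nonneg_pos)
    qed
    then have "(i, y) \<in> (drop_edges n ?c)\<^sup>*" if "i < n" for i
      using b(3)[OF that] rtrancl_mono by blast
    then show ?thesis using det_nonzero_of_sink[OF n c sq b(2)] by simp
  qed
qed

lemma det_pos_of_sink:
  fixes a :: "nat \<Rightarrow> nat \<Rightarrow> real"
  assumes n: "n \<ge> 1"
    and a: "offdiag_drops_nonneg n a" "z < n" "\<And>i. i < n \<Longrightarrow> (i, z) \<in> (drop_edges n a)\<^sup>*"
    and pos: "\<And>i. i < n \<Longrightarrow> (\<Sum>j<n. a i j) > 0"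
  shows "det (mat n n (\<lambda>(i, j). a i j)) > 0"
proof -
  let ?b = "\<lambda>i j. if i = j then 1 else 0 :: real"
  \<comment> \<open>In the identity each \<open>k < n - 1\<close> has an edge to
    \<open>Suc k\<close>, so \<open>n - 1\<close> is a sink.\<close>
  have "(i, n - 1) \<in> (drop_edges n ?b)\<^sup>*" if "i \<le> n - 1" for i
    using that
  proof (induction rule: inc_induct)
    case (step k)
    then have "(k, Suc k) \<in> drop_edges n ?b"
      by (auto simp: drop_edges_def cyclic_drop_def cyclic_pred_def)
    then show ?case using step.IH by (rule converse_rtrancl_into_rtrancl)
  qed simp
  moreover have "offdiag_drops_nonneg n ?b"
    by (auto simp: offdiag_drops_nonneg_def cyclic_drop_def)
  ultimately have "sgn (det (mat n n (\<lambda>(i, j). a i j))) = sgn (det (mat n n (\<lambda>(i, j). ?b i j)))"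
    using n pos
    by (intro det_sgn_eq_of_sinks[OF n a, where s = 1 and y = "n - 1"]) (auto simp: cyclic_drop_def)
  also have "mat n n (\<lambda>(i, j). ?b i j) = 1\<^sub>m n" by (intro eq_matI) auto
  finally show ?thesis by (simp add: sgn_1_pos)
qed

text \<open>Row 0 has its single entry -1 in the last column, and the corresponding minor is that of
  minus the identity. Its sign \<open>(-1) ^ m\<close> cancels the cofactor sign, whatever the
  parity of \<open>m\<close>.\<close>

lemma det_neg_cycle:
  assumes "n \<ge> 1"
  shows "det (mat n n (\<lambda>(i, j). if j = cyclic_pred n i then -1 else 0 :: real)) = -1"
proof -
  obtain m where m: "n = Suc m" using assms by (cases n) auto
  let ?B = "mat n n (\<lambda>(i, j). if j = cyclic_pred n i then -1 else 0 :: real)"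
  have del: "mat_delete ?B 0 m = (-1) \<cdot>\<^sub>m 1\<^sub>m m"
    by (intro eq_matI) (auto simp: mat_delete_def m cyclic_pred_def)
  have "det ?B = (\<Sum>j<n. ?B $$ (0, j) * cofactor ?B 0 j)"
    using assms by (intro laplace_expansion_row) auto
  also have "\<dots> = (\<Sum>j<n. if j = m then - cofactor ?B 0 m else 0)"
    by (intro sum.cong) (auto simp: m cyclic_pred_def)
  also have "\<dots> = - cofactor ?B 0 m" by (simp add: m)
  also have "\<dots> = -1" unfolding cofactor_def del by (simp flip: power_mult_distrib)
  finally show ?thesis .
qed

lemma det_neg_of_sink:
  fixes a :: "nat \<Rightarrow> nat \<Rightarrow> real"
  assumes n: "n \<ge> 1"
    and a: "offdiag_drops_nonneg n a" "z < n" "\<And>i. i < n \<Longrightarrow> (i, z) \<in> (drop_edges n a)\<^sup>*"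
    and neg: "\<And>i. i < n \<Longrightarrow> (\<Sum>j<n. a i j) < 0"
  shows "det (mat n n (\<lambda>(i, j). a i j)) < 0"
proof -
  \<comment> \<open>For \<open>n \<ge> 2\<close> minus the identity would have a negative drop just
    after the diagonal. Placing the -1 one column earlier moves that drop onto the diagonal; the
    edges then go from \<open>i\<close> to \<open>cyclic_pred n i\<close>, and 0 is a sink.\<close>
  let ?b = "\<lambda>i j. if j = cyclic_pred n i then -1 else 0 :: real"
  have inj: "cyclic_pred n j = cyclic_pred n i \<longleftrightarrow> i = j" if "i < n" "j < n" for i j
    using that by (auto simp: cyclic_pred_def split: if_splits)
  have "(i, 0) \<in> (drop_edges n ?b)\<^sup>*" if "i < n" for i
    using that
  proof (induction i)
    case (Suc k)
    then have "(Suc k, k) \<in> drop_edges n ?b"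
      by (auto simp: drop_edges_def cyclic_drop_def cyclic_pred_def)
    then show ?case using Suc by (meson converse_rtrancl_into_rtrancl Suc_lessD)
  qed simp
  moreover have "offdiag_drops_nonneg n ?b"
    by (auto simp: offdiag_drops_nonneg_def cyclic_drop_def inj)
  ultimately have "sgn (det (mat n n (\<lambda>(i, j). a i j))) = sgn (det (mat n n (\<lambda>(i, j). ?b i j)))"
    using n neg
    by (intro det_sgn_eq_of_sinks[OF n a, where s = "-1" and y = 0])
       (auto simp: cyclic_drop_def cyclic_pred_less)
  then show ?thesis unfolding det_neg_cycle[OF n] by (simp add: sgn_1_neg)
qed

section \<open>Closed sets and left null vectors\<close>

text \<open>A square matrix has nonzero left null vectors as soon as it has right ones, so the right
  null vector given by the indicator of \<open>C\<close> yields a left one.\<close>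

lemma left_multiplier_on_closed_set:
  assumes n: "n \<ge> 1" and nonneg: "offdiag_drops_nonneg n a"
    and C: "C \<subseteq> {..<n}" "C \<noteq> {}"
    and closed: "drop_edges n a `` C \<subseteq> C"
  obtains x c where "\<exists>i\<in>C. x i \<noteq> 0" "\<And>i. i \<notin> C \<Longrightarrow> x i = 0"
    "\<And>j. j < n \<Longrightarrow> (\<Sum>i<n. x i * a i j) = c"
proof -
  have zero: "cyclic_drop n a i j = 0" if "i \<in> C" "j < n" "j \<notin> C" for i j
  proof -
    have "i < n" "i \<noteq> j" "(i, j) \<notin> drop_edges n a" using closed that C(1) by auto
    then show ?thesis using nonneg that(2) by (force simp: drop_edges_def offdiag_drops_nonneg_def)
  qed
  \<comment> \<open>The Laplacian restricted to \<open>C\<close>, padded by the identity so that it stays \<open>n \<times> n\<close>. It kills the indicator of \<open>C\<close>.\<close>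
  define m where "m i j = (if i \<in> C then cyclic_drop n a i j else if i = j then 1 else 0)" for i j
  have "(\<Sum>j<n. m i j * (if j \<in> C then 1 else 0)) = 0" if "i < n" for i
  proof (cases "i \<in> C")
    case True
    have "(\<Sum>j<n. m i j * (if j \<in> C then 1 else 0)) = (\<Sum>j<n. cyclic_drop n a i j)"
      using True zero by (intro sum.cong) (auto simp: m_def)
    then show ?thesis using sum_cyclic_drop[OF n] by simp
  next
    case False
    then show ?thesis by (intro sum.neutral) (auto simp: m_def)
  qed
  moreover have "\<exists>i<n. (if i \<in> C then 1 else 0 :: real) \<noteq> 0" using C by auto
  ultimately have "det (mat n n (\<lambda>(i, j). m i j)) = 0"
    unfolding det_mat_0_iff by (intro exI[of _ "\<lambda>j. if j \<in> C then 1 else 0"] conjI allI impI)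
  then obtain x where x: "\<exists>i<n. x i \<noteq> 0" "\<And>j. j < n \<Longrightarrow> (\<Sum>i<n. x i * m i j) = 0"
    unfolding det_mat_0_iff_left by blast
  \<comment> \<open>No drop leads out of \<open>C\<close>, so column \<open>j\<close> of
    \<open>m\<close> is a unit vector and the padding forces \<open>x j\<close> to vanish.\<close>
  have x0: "x j = 0" if "j < n" "j \<notin> C" for j
  proof -
    have "(\<Sum>i<n. x i * m i j) = (\<Sum>i<n. if i = j then x j else 0)"
      using that zero by (intro sum.cong) (auto simp: m_def)
    then show ?thesis using x(2)[OF that(1)] that by simp
  qed
  \<comment> \<open>\<open>x\<close> is arbitrary at indices from \<open>n\<close> on;
    \<open>y\<close> cuts it off so that it vanishes everywhere outside \<open>C\<close>.\<close>
  define y where "y i = (if i \<in> C then x i else 0)" for i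
  have y: "(\<Sum>i<n. y i * cyclic_drop n a i j) = 0" if "j < n" for j
  proof -
    have "(\<Sum>i<n. y i * cyclic_drop n a i j) = (\<Sum>i<n. x i * m i j)"
      using x0 by (intro sum.cong) (auto simp: m_def y_def)
    then show ?thesis using x(2)[OF that] by simp
  qed
  \<comment> \<open>Orthogonality to the drops at \<open>Suc j\<close> says that columns
    \<open>j\<close> and \<open>Suc j\<close> have equal weighted sums.\<close>
  have "(\<Sum>i<n. y i * a i j) = (\<Sum>i<n. y i * a i 0)" if "j < n" for j
    using that
  proof (induction j)
    case (Suc j)
    then show ?case using y[of "Suc j"]
      by (simp add: cyclic_drop_def cyclic_pred_def right_diff_distrib sum_subtractf)
  qed simp
  moreover have "\<exists>i\<in>C. y i \<noteq> 0" using x(1) x0 by (auto simp: y_def)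
  moreover have "y i = 0" if "i \<notin> C" for i using that by (simp add: y_def)
  ultimately show thesis by (intro that[of y "\<Sum>i<n. y i * a i 0"])
qed

lemma det_zero_of_disjoint_closed_sets:
  fixes a :: "nat \<Rightarrow> nat \<Rightarrow> real"
  assumes n: "n \<ge> 1" and nonneg: "offdiag_drops_nonneg n a"
    and C: "C \<subseteq> {..<n}" "C \<noteq> {}" "drop_edges n a `` C \<subseteq> C"
    and D: "D \<subseteq> {..<n}" "D \<noteq> {}" "drop_edges n a `` D \<subseteq> D"
    and disj: "C \<inter> D = {}"
  shows "det (mat n n (\<lambda>(i, j). a i j)) = 0"
proof -
  obtain x c where x: "\<exists>i\<in>C. x i \<noteq> 0" "\<And>i. i \<notin> C \<Longrightarrow> x i = 0" "\<And>j. j < n \<Longrightarrow> (\<Sum>i<n. x i * a i j) = c"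
    using left_multiplier_on_closed_set[OF n nonneg C] by blast
  obtain y d where y: "\<exists>i\<in>D. y i \<noteq> 0" "\<And>i. i \<notin> D \<Longrightarrow> y i = 0" "\<And>j. j < n \<Longrightarrow> (\<Sum>i<n. y i * a i j) = d"
    using left_multiplier_on_closed_set[OF n nonneg D] by blast
  show ?thesis
  proof (cases "d = 0")
    case True
    have "\<exists>i<n. y i \<noteq> 0" using y(1) D(1) by auto
    then show ?thesis unfolding det_mat_0_iff_left using y(3) True by blast
  next
    case False
    \<comment> \<open>The combination \<open>d * x - c * y\<close> cancels the two constants;
      disjoint supports keep it nonzero at a point of \<open>C\<close>.\<close>
    obtain i where i: "i \<in> C" "x i \<noteq> 0" using x(1) by blast
    then have "y i = 0" using disj by (intro y(2)) auto
    then have "d * x i - c * y i \<noteq> 0" using i(2) False by simp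
    moreover have "(\<Sum>i<n. (d * x i - c * y i) * a i j) = 0" if "j < n" for j
    proof -
      have "(\<Sum>i<n. (d * x i - c * y i) * a i j) = d * (\<Sum>i<n. x i * a i j) - c * (\<Sum>i<n. y i * a i j)"
        by (simp add: sum_distrib_left left_diff_distrib sum_subtractf mult.assoc)
      then show ?thesis using x(3) y(3) that by simp
    qed
    ultimately show ?thesis
      unfolding det_mat_0_iff_left using i(1) C(1)
      by (intro exI[of _ "\<lambda>i. d * x i - c * y i"]) auto
  qed
qed

section \<open>Closed components of the matrix graph\<close>

lemma kappa_eq_1_iff:
  assumes "j < n"
  shows "kappa n A i j = 1 \<longleftrightarrow> cyclic_drop n (\<lambda>i j. A $$ (i, j)) i j > 0"
  using assms by (auto simp: kappa_def cyclic_drop_def cyclic_pred_def)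

lemma parcs_matrix_graph: "parcs (matrix_graph n A) = drop_edges n (\<lambda>i j. A $$ (i, j))"
  by (auto simp: matrix_graph_def drop_edges_def kappa_eq_1_iff simp del: One_nat_def)

text \<open>\<open>reachable\<close> asks for a vertex even on the empty path, while the reflexive
  closure relates every number to itself; \<open>i < n\<close> reconciles the two.\<close>

lemma reachable_matrix_graph_iff:
  assumes "i < n"
  shows "reachable (with_proj (matrix_graph n A)) i j \<longleftrightarrow> (i, j) \<in> (drop_edges n (\<lambda>i j. A $$ (i, j)))\<^sup>*"
    (is "_ \<longleftrightarrow> _ \<in> ?E\<^sup>*")
proof -
  interpret pair_wf_digraph "matrix_graph n A" by (rule pair_wf_matrix_graph)
  have ends: "arcs_ends (with_proj (matrix_graph n A)) = ?E"
    by (auto simp: arcs_ends_def arc_to_ends_def parcs_matrix_graph)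
  have verts: "verts (with_proj (matrix_graph n A)) = {0..<n}"
    by (simp add: matrix_graph_def)
  show ?thesis
  proof
    assume "(i, j) \<in> ?E\<^sup>*"
    then show "reachable (with_proj (matrix_graph n A)) i j"
    proof (induction rule: rtrancl_induct)
      case base
      then show ?case using assms by (simp add: reachable_def matrix_graph_def)
    next
      case (step k l)
      then show ?case using ends by (auto intro: reachable_adj_trans)
    qed
  next
    assume "reachable (with_proj (matrix_graph n A)) i j"
    then show "(i, j) \<in> ?E\<^sup>*"
      unfolding reachable_def ends by (rule rtrancl_on_rtranclI)
  qed
qed

lemma strong_connection_matrix_graph_iff:
  "(i, j) \<in> strong_connection (matrix_graph n A) \<longleftrightarrow> i < n \<and> j < n \<and>
    (i, j) \<in> (drop_edges n (\<lambda>i j. A $$ (i, j)))\<^sup>* \<and> (j, i) \<in> (drop_edges n (\<lambda>i j. A $$ (i, j)))\<^sup>*"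
proof -
  have "pverts (matrix_graph n A) = {0..<n}" by (simp add: matrix_graph_def)
  then show ?thesis by (auto simp: strong_connection_def reachable_matrix_graph_iff)
qed

lemma closed_SCC_subset:
  assumes "closed_SCC (matrix_graph n A) C"
  shows "C \<subseteq> {..<n}"
  using assms
  by (auto simp: closed_SCC_def SCCs_def strong_connection_matrix_graph_iff elim!: quotientE)

lemma closed_SCC_nonempty:
  assumes "closed_SCC (matrix_graph n A) C"
  shows "C \<noteq> {}"
  using assms in_quotient_imp_non_empty[OF equiv_strong_connection[OF pair_wf_matrix_graph]]
  by (auto simp: closed_SCC_def SCCs_def)

lemma closed_SCC_edges:
  assumes "closed_SCC (matrix_graph n A) C"
  shows "drop_edges n (\<lambda>i j. A $$ (i, j)) `` C \<subseteq> C"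
  using assms by (auto simp: closed_SCC_def open_SCC_def parcs_matrix_graph)

lemma closed_SCC_disjoint:
  assumes "closed_SCC (matrix_graph n A) C" "closed_SCC (matrix_graph n A) D" "C \<noteq> D"
  shows "C \<inter> D = {}"
  using assms quotient_disj[OF equiv_strong_connection[OF pair_wf_matrix_graph[of n A]], of C D]
  unfolding closed_SCC_def SCCs_def by blast

lemma closed_SCC_reachable:
  assumes "closed_SCC (matrix_graph n A) C" "i \<in> C" "j \<in> C"
  shows "(i, j) \<in> (drop_edges n (\<lambda>i j. A $$ (i, j)))\<^sup>*"
proof -
  have "(i, j) \<in> strong_connection (matrix_graph n A)"
    using assms quotient_eq_iff[OF equiv_strong_connection[OF pair_wf_matrix_graph]]
    by (metis closed_SCC_def SCCs_def)
  then show ?thesis by (simp add: strong_connection_matrix_graph_iff)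
qed

lemma reaches_closed_SCC:
  assumes "i < n"
  obtains C j where "closed_SCC (matrix_graph n A) C" "j \<in> C"
    "(i, j) \<in> (drop_edges n (\<lambda>i j. A $$ (i, j)))\<^sup>*"
proof -
  let ?E = "drop_edges n (\<lambda>i j. A $$ (i, j))"
  let ?R = "\<lambda>j. ?E\<^sup>* `` {j}"
  have lt: "k < n" if "(j, k) \<in> ?E\<^sup>*" "j < n" for j k
    using that by (induction rule: rtrancl_induct) (auto simp: drop_edges_def)
  obtain j where j: "(i, j) \<in> ?E\<^sup>*" "\<And>k. (i, k) \<in> ?E\<^sup>* \<Longrightarrow> card (?R j) \<le> card (?R k)"
    using ex_has_least_nat[of "\<lambda>j. (i, j) \<in> ?E\<^sup>*" i "\<lambda>j. card (?R j)"] by auto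
  have jn: "j < n" using lt j(1) assms by blast
  have fin: "finite (?R j)" using lt jn by (auto intro: finite_subset[of _ "{..<n}", OF _ finite_lessThan])
  \<comment> \<open>Minimality turns the inclusion of the finite reachable sets into equality, so
    \<open>j\<close> is itself reachable from \<open>k\<close>.\<close>
  have returns: "(k, j) \<in> ?E\<^sup>*" if jk: "(j, k) \<in> ?E\<^sup>*" for k
  proof -
    have "?R k \<subseteq> ?R j" using jk by (auto intro: rtrancl_trans)
    moreover have "card (?R j) \<le> card (?R k)" using j jk by (blast intro: rtrancl_trans)
    ultimately have "?R k = ?R j" using fin by (metis card_seteq)
    then show ?thesis by blast
  qed
  \<comment> \<open>\<open>j\<close> has a smallest reachable set among the vertices reachable from \<open>i\<close>, so its component is closed.\<close>
  let ?C = "strong_connection (matrix_graph n A) `` {j}"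
  have "?C \<in> SCCs (matrix_graph n A)"
    unfolding SCCs_def using jn by (intro quotientI) (simp add: matrix_graph_def)
  moreover have "l \<in> ?C" if "k \<in> ?C" "(k, l) \<in> ?E" for k l
  proof -
    have "(j, l) \<in> ?E\<^sup>*" using that by (auto simp: strong_connection_matrix_graph_iff)
    then show ?thesis using jn lt returns by (auto simp: strong_connection_matrix_graph_iff)
  qed
  ultimately have "closed_SCC (matrix_graph n A) ?C"
    by (auto simp: closed_SCC_def open_SCC_def parcs_matrix_graph)
  moreover have "j \<in> ?C" using jn by (auto simp: strong_connection_matrix_graph_iff)
  ultimately show thesis using j(1) by (rule that)
qed

text \<open>Every vertex reaches some closed component. When there is only one, its members reach
  each other and any of them is a sink.\<close>

lemma sink_of_unique_closed_SCC:
  assumes "n \<ge> 1" "card {C. closed_SCC (matrix_graph n A) C} \<le> 1"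
  obtains z where "z < n" "\<And>i. i < n \<Longrightarrow> (i, z) \<in> (drop_edges n (\<lambda>i j. A $$ (i, j)))\<^sup>*"
proof -
  \<comment> \<open>An infinite family would also have \<open>card\<close> equal to 0, so finiteness
    must precede uniqueness.\<close>
  have "finite {C. closed_SCC (matrix_graph n A) C}"
    using closed_SCC_subset by (auto intro!: finite_subset[of "{C. _ C}" "Pow {..<n}"])
  then have uniq: "C = D" if "closed_SCC (matrix_graph n A) C" "closed_SCC (matrix_graph n A) D" for C D
    using assms(2) that by (auto simp: card_le_Suc0_iff_eq)
  have "0 < n" using assms(1) by simp
  then obtain C z where C: "closed_SCC (matrix_graph n A) C" "z \<in> C"
    by (rule reaches_closed_SCC)
  show thesis
  proof (rule that)
    show "z < n" using C closed_SCC_subset by blast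
  next
    fix i assume "i < n"
    then obtain D j where "closed_SCC (matrix_graph n A) D" "j \<in> D"
      "(i, j) \<in> (drop_edges n (\<lambda>i j. A $$ (i, j)))\<^sup>*"
      by (rule reaches_closed_SCC)
    then show "(i, z) \<in> (drop_edges n (\<lambda>i j. A $$ (i, j)))\<^sup>*"
      using C uniq closed_SCC_reachable by (blast intro: rtrancl_trans)
  qed
qed

section \<open>From row monotonicity to the determinant\<close>

lemma offdiag_drops_nonneg_of_cyclically_nonincreasing:
  assumes "cyclically_nonincreasing_rows n A"
  shows "offdiag_drops_nonneg n (\<lambda>i j. A $$ (i, j))"
  unfolding offdiag_drops_nonneg_def
proof (intro allI impI)
  fix i j assume ij: "i < n" "j < n" "i \<noteq> j"
  \<comment> \<open>\<open>k\<close> counts the cyclic steps from column \<open>i\<close> to the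
    predecessor of \<open>j\<close>; \<open>j \<noteq> i\<close> keeps \<open>k + 1\<close> below
    \<open>n\<close>.\<close>
  define k where "k = (if i < j then j - i - 1 else n + j - i - 1)"
  have "k + 1 < n" using ij by (auto simp: k_def)
  moreover have "(i + k + 1) mod n = j" using ij by (auto simp: k_def)
  moreover have "(i + k) mod n = cyclic_pred n j"
  proof -
    consider "i < j" | "j = 0" | "j < i" "0 < j" using ij by linarith
    then show ?thesis
    proof cases
      case 3
      then have "i + k = n + (j - 1)" using ij by (simp add: k_def)
      then show ?thesis using 3 ij by (simp add: cyclic_pred_def del: Nat.add_diff_assoc)
    qed (use ij in \<open>auto simp: k_def cyclic_pred_def\<close>)
  qed
  ultimately show "cyclic_drop n (\<lambda>i j. A $$ (i, j)) i j \<ge> 0"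
    using assms ij(1) unfolding cyclically_nonincreasing_rows_def cyclic_drop_def by force
qed

theorem mainTheorem5:
  fixes n :: nat and A :: "real mat"
  assumes "n \<ge> 1"
    and "A \<in> carrier_mat n n"
    and "cyclically_nonincreasing_rows n A"
  shows "(vec_pos (A *\<^sub>v ones_vec n) \<longrightarrow>
            (if card {C. closed_SCC (matrix_graph n A) C} > 1 then det A = 0 else det A > 0)) \<and>
         (vec_neg (A *\<^sub>v ones_vec n) \<longrightarrow>
            (if card {C. closed_SCC (matrix_graph n A) C} > 1 then det A = 0 else det A < 0))"
proof -
  let ?a = "\<lambda>i j. A $$ (i, j)"
  have A: "mat n n (\<lambda>(i, j). ?a i j) = A" using assms(2) by (intro eq_matI) auto
  note nonneg = offdiag_drops_nonneg_of_cyclically_nonincreasing[OF assms(3)]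
  have row: "(A *\<^sub>v ones_vec n) $ i = (\<Sum>j<n. ?a i j)" if "i < n" for i
    using that assms(2) by (simp add: ones_vec_def scalar_prod_def lessThan_atLeast0)
  have dim: "dim_vec (A *\<^sub>v ones_vec n) = n" using assms(2) by simp
  have pos_rows: "(\<Sum>j<n. ?a i j) > 0" if "vec_pos (A *\<^sub>v ones_vec n)" "i < n" for i
    using that unfolding vec_pos_def dim row[OF that(2), symmetric] by blast
  have neg_rows: "(\<Sum>j<n. ?a i j) < 0" if "vec_neg (A *\<^sub>v ones_vec n)" "i < n" for i
    using that unfolding vec_neg_def dim row[OF that(2), symmetric] by blast
  show ?thesis
  proof (cases "card {C. closed_SCC (matrix_graph n A) C} > 1")
    case True
    \<comment> \<open>A cardinality above 1 is nonzero, so the family is finite and has two distinct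
      members.\<close>
    then obtain C D where CD: "closed_SCC (matrix_graph n A) C" "closed_SCC (matrix_graph n A) D" "C \<noteq> D"
      using card_le_Suc0_iff_eq[OF card_ge_0_finite, of "{C. closed_SCC (matrix_graph n A) C}"]
      by (auto simp: not_le)
    have "det (mat n n (\<lambda>(i, j). ?a i j)) = 0"
      using closed_SCC_disjoint[OF CD] CD(1,2)
      by (intro det_zero_of_disjoint_closed_sets[OF assms(1) nonneg, of C D]
          closed_SCC_subset closed_SCC_nonempty closed_SCC_edges)
    then show ?thesis using True A by simp
  next
    case False
    then obtain z where z: "z < n" "\<And>i. i < n \<Longrightarrow> (i, z) \<in> (drop_edges n ?a)\<^sup>*"
      using sink_of_unique_closed_SCC[OF assms(1), of A] by (auto simp: not_less)
    have "det A > 0" if "vec_pos (A *\<^sub>v ones_vec n)"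
      using det_pos_of_sink[OF assms(1) nonneg z pos_rows[OF that]] by (simp only: A)
    moreover have "det A < 0" if "vec_neg (A *\<^sub>v ones_vec n)"
      using det_neg_of_sink[OF assms(1) nonneg z neg_rows[OF that]] by (simp only: A)
    ultimately show ?thesis using False by simp
  qed
qed

end
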